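(* Let $V$ be a separable real Hilbert space with scalar product $(\cdot,\cdot)_V$ and norm $\|\cdot\|_V$, and let $F:V\to\mathcal{CBC}(V)$ be compactly upper hemicontinuous (c-uhc), bounded on bounded sets and $l$-relaxed one-sided Lipschitz with $l<0$. Then its inverse $F^{-1}:V\rightrightarrows V$ has nonempty weakly sequentially closed images, it is $-\tfrac1l$-Lipschitz, and it is $0$-relaxed one-sided Lipschitz. Moreover, the images of $F^{-1}$ satisfy the explicit and implicit bounds $$\|F^{-1}(y)\|_V\le-\tfrac1l\|F(0)\|_V-\tfrac1l\|y\|_V,$$ $$\mathrm{diam}_V(F^{-1}(y))\le-\tfrac1l\sup_{x\in F^{-1}(y)}\mathrm{diam}_V F(x)$$ for any $y\in V$. In particular, $F^{-1}$ is bounded on bounded sets.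
   Context: $\mathcal{CBC}(V)$ is the set of all nonempty closed, bounded and convex subsets of $V$. $F^{-1}(y)=\{x\in V: y\in F(x)\}$. For nonempty $M\subset V$, $\|M\|_V=\sup_{x\in M}\|x\|_V$ and $\mathrm{diam}_V M=\sup_{x,x'\in M}\|x-x'\|_V$. A set-valued map is bounded on bounded sets if the union of its images over any bounded set is bounded. $F:V\to\mathcal{CBC}(V)$ is c-uhc if for any sequence $(x_k)_k\subset V$ converging weakly to some $x\in V$ one has $\limsup_{k\to\infty}\sigma_V(v,F(x_k))\le\sigma_V(v,F(x))$ for all $v\in V$, where $\sigma_V(v,A)=\sup_{y\in A}(y,v)_V$. A mapping $G:V\rightrightarrows V$ is $\lambda$-relaxed one-sided Lipschitz ($\lambda\in\mathbb{R}$) if for any $x,x'\in V$ and $y\in G(x)$ there exists $y'\in G(x')$ such that $(y'-y,x'-x)_V\le\lambda\|x'-x\|_V^2$. A set-valued mapping $G:V\rightrightarrows V$ with nonempty images is $L$-Lipschitz if $e_V(G(y),G(y'))\le L\|y-y'\|_V$ for all $y,y'\in V$, where $e_V(M,M')=\sup_{x\in M}\inf_{x'\in M'}\|x-x'\|_V$. *)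

theory Defs
  imports "HOL-Analysis.Analysis"
begin

(* Suprema and infima are taken in ereal, so that no boundedness is presupposed. On the
   empty set SUP is -\<infinity>, but these quantities are only meant for nonempty sets. *)

definition CBC :: "'v::real_normed_vector set set" where
  "CBC = {A. A \<noteq> {} \<and> closed A \<and> bounded A \<and> convex A}"

definition inverse_setmap :: "('v \<Rightarrow> 'w set) \<Rightarrow> 'w \<Rightarrow> 'v set" where
  "inverse_setmap F y = {x. y \<in> F x}"

definition set_norm :: "'v::real_normed_vector set \<Rightarrow> ereal" where
  "set_norm M = (SUP x\<in>M. ereal (norm x))"

definition set_diam :: "'v::real_normed_vector set \<Rightarrow> ereal" where
  "set_diam M = (SUP x\<in>M. SUP x'\<in>M. ereal (norm (x - x')))"

definition excess :: "'v::real_normed_vector set \<Rightarrow> 'v set \<Rightarrow> ereal" where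
  "excess M M' = (SUP x\<in>M. INF x'\<in>M'. ereal (norm (x - x')))"

definition support_fun :: "'v::real_inner \<Rightarrow> 'v set \<Rightarrow> ereal" where
  "support_fun v A = (SUP y\<in>A. ereal (inner y v))"

definition weakly_converges :: "(nat \<Rightarrow> 'v::real_normed_vector) \<Rightarrow> 'v \<Rightarrow> bool" where
  "weakly_converges X x \<longleftrightarrow>
     (\<forall>f :: 'v \<Rightarrow> real. bounded_linear f \<longrightarrow> (\<lambda>k. f (X k)) \<longlonglongrightarrow> f x)"

definition weakly_seq_closed :: "'v::real_normed_vector set \<Rightarrow> bool" where
  "weakly_seq_closed A \<longleftrightarrow>
     (\<forall>X x. (\<forall>k. X k \<in> A) \<longrightarrow> weakly_converges X x \<longrightarrow> x \<in> A)"

definition bounded_on_bounded_sets ::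
    "('v::real_normed_vector \<Rightarrow> 'w::real_normed_vector set) \<Rightarrow> bool" where
  "bounded_on_bounded_sets G \<longleftrightarrow> (\<forall>B. bounded B \<longrightarrow> bounded (\<Union>x\<in>B. G x))"

definition c_uhc :: "('v::real_inner \<Rightarrow> 'v set) \<Rightarrow> bool" where
  "c_uhc F \<longleftrightarrow>
     (\<forall>X x. weakly_converges X x \<longrightarrow>
        (\<forall>v. limsup (\<lambda>k. support_fun v (F (X k))) \<le> support_fun v (F x)))"

definition relaxed_one_sided_lipschitz :: "real \<Rightarrow> ('v::real_inner \<Rightarrow> 'v set) \<Rightarrow> bool" where
  "relaxed_one_sided_lipschitz c G \<longleftrightarrow>
     (\<forall>x x'. \<forall>y\<in>G x. \<exists>y'\<in>G x'. inner (y' - y) (x' - x) \<le> c * (norm (x' - x))\<^sup>2)"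

definition set_lipschitz :: "real \<Rightarrow> ('v::real_normed_vector \<Rightarrow> 'v set) \<Rightarrow> bool" where
  "set_lipschitz L G \<longleftrightarrow>
     (\<forall>y. G y \<noteq> {}) \<and>
     (\<forall>y y'. excess (G y) (G y') \<le> ereal (L * norm (y - y')))"

end

theory Submission
  imports Defs "HOL-Complex_Analysis.Great_Picard"
begin

text \<open>
  Everything follows from one solvability statement: if \<open>y0 \<in> F x0\<close>, then for every \<open>y\<close> there
  is an \<open>x\<close> with \<open>y \<in> F x\<close> and \<open>(y - y0, x - x0) \<le> l |x - x0|\<^sup>2\<close>
  (lemma \<open>solvability_in_dissipativity_region\<close>). Since \<open>l < 0\<close>, the inequality says both that
  \<open>(y - y0, x - x0) \<le> 0\<close>, which is the relaxed one-sided Lipschitz property of the inverse, and,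
  by Cauchy-Schwarz, that \<open>|x - x0| \<le> |y - y0| / (- l)\<close>, which is its Lipschitz property. The
  norm and diameter bounds only need that the one-sided Lipschitz condition of \<open>F\<close> itself produces
  such an inequality with a second element of \<open>F 0\<close> or of \<open>F x'\<close>.

  For the solvability statement, let \<open>B\<close> be the set of all \<open>x\<close> that satisfy the inequality. It is
  a closed ball with \<open>x0\<close> on its boundary, hence weakly sequentially compact. Suppose that
  \<open>y \<notin> F x\<close> for all \<open>x \<in> B\<close>. Each \<open>x \<in> B\<close> then has a direction \<open>v\<close>, which may be taken from a
  countable dense set and scaled, such that \<open>(z - y, v) < -1\<close> for all \<open>z \<in> F x\<close>. By c-upper
  hemicontinuity, the set of all \<open>x\<close> for which a given \<open>v\<close> has this property is weakly
  sequentially open, so that finitely many directions \<open>d n\<close> suffice for all of \<open>B\<close>. Continuous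
  weights \<open>\<phi> n\<close>, positive exactly where \<open>d n\<close> separates, and \<open>\<phi>0\<close>, vanishing exactly on \<open>B\<close>, sum up to 1.
  For any \<open>\<tau> > 0\<close>, Brouwer's theorem, applied to the coefficients in the span of the \<open>d n\<close>,
  yields a point \<open>x\<close> with
  \<open>\<phi>0 x (x - x0) + (\<Sum>n. \<phi> n x d n) = - \<tau> (x - x0)\<close>.
  Pair this equation with \<open>z - y\<close>, where \<open>z \<in> F x\<close> is the partner of \<open>y0 \<in> F x0\<close> in the one-sided
  Lipschitz condition, so that \<open>(z - y, x - x0) \<le> l |x - x0|\<^sup>2 - (y - y0, x - x0)\<close>. If
  \<open>x \<notin> B\<close>, then \<open>(z - y, x - x0) < 0\<close>, whereas the equation forces it to be nonnegative. If
  \<open>x \<in> B\<close>, the left-hand side paired with \<open>z - y\<close> is at most \<open>-1\<close>, while the right-hand side is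
  close to 0 for small \<open>\<tau>\<close>, because \<open>F\<close> is bounded on \<open>B\<close>.
\<close>

section \<open>Projection, separation and Riesz representation in Hilbert space\<close>

lemma closest_point_exists_hilbert:
  fixes A :: "'v::{real_inner, complete_space} set"
  assumes "A \<noteq> {}" "closed A" "convex A"
  obtains a where "a \<in> A" "\<And>z. z \<in> A \<Longrightarrow> norm (a - p) \<le> norm (z - p)"
proof -
  \<comment> \<open>A minimizing sequence is Cauchy by the parallelogram law.\<close>
  define d where "d = infdist p A"
  have d0: "d \<ge> 0" by (simp add: d_def infdist_nonneg)
  have d_le: "d \<le> norm (z - p)" if "z \<in> A" for z
    using infdist_le[OF that, of p] by (simp add: d_def dist_norm norm_minus_commute)
  have "\<exists>a\<in>A. (norm (a - p))\<^sup>2 < d\<^sup>2 + inverse (real (Suc n))" for n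
  proof -
    have "sqrt (d\<^sup>2) < sqrt (d\<^sup>2 + inverse (real (Suc n)))"
      by (intro real_sqrt_less_mono) simp
    then have "infdist p A < sqrt (d\<^sup>2 + inverse (real (Suc n)))"
      using d0 by (simp add: d_def)
    then obtain a where "a \<in> A" "norm (a - p) < sqrt (d\<^sup>2 + inverse (real (Suc n)))"
      using assms(1) cINF_less_iff[OF _ bdd_belowI2, of A 0 "dist p"]
      by (auto simp: infdist_notempty dist_norm norm_minus_commute)
    moreover have "(sqrt (d\<^sup>2 + inverse (real (Suc n))))\<^sup>2 = d\<^sup>2 + inverse (real (Suc n))"
      by (intro real_sqrt_pow2) simp
    ultimately show ?thesis
      by (metis norm_ge_zero power_strict_mono zero_less_numeral)
  qed
  then obtain a where aA: "\<And>n. a n \<in> A"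
    and ad: "\<And>n. (norm (a n - p))\<^sup>2 < d\<^sup>2 + inverse (real (Suc n))"
    by metis
  have close: "(norm (a m - a n))\<^sup>2 \<le> 2 * inverse (real (Suc m)) + 2 * inverse (real (Suc n))" for m n
  proof -
    have "(1/2) *\<^sub>R a m + (1/2) *\<^sub>R a n \<in> A"
      using convexD[OF assms(3) aA aA, of "1/2" "1/2"] by simp
    from d_le[OF this] have "d\<^sup>2 \<le> (norm ((1/2) *\<^sub>R a m + (1/2) *\<^sub>R a n - p))\<^sup>2"
      using d0 by (intro power_mono) auto
    moreover have "(norm (a m - a n))\<^sup>2 = 2 * (norm (a m - p))\<^sup>2 + 2 * (norm (a n - p))\<^sup>2
        - 4 * (norm ((1/2) *\<^sub>R a m + (1/2) *\<^sub>R a n - p))\<^sup>2"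
      unfolding power2_norm_eq_inner
      by (simp add: algebra_simps inner_commute)
    ultimately show ?thesis using ad[of m] ad[of n] by linarith
  qed
  have "Cauchy a"
  proof (rule metric_CauchyI)
    fix e :: real assume "e > 0"
    then obtain N where N: "inverse (real (Suc N)) < e\<^sup>2 / 4"
      using reals_Archimedean[of "e\<^sup>2/4"] by auto
    have "dist (a m) (a n) < e" if "m \<ge> N" "n \<ge> N" for m n
    proof -
      have "inverse (real (Suc m)) \<le> inverse (real (Suc N))"
        "inverse (real (Suc n)) \<le> inverse (real (Suc N))"
        using that by (simp_all add: le_imp_inverse_le del: of_nat_Suc)
      then have "(norm (a m - a n))\<^sup>2 < e\<^sup>2"
        using close[of m n] N by linarith
      then show ?thesis using \<open>e > 0\<close>
        by (simp add: dist_norm power_less_imp_less_base)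
    qed
    then show "\<exists>M. \<forall>m\<ge>M. \<forall>n\<ge>M. dist (a m) (a n) < e" by blast
  qed
  then obtain b where b: "a \<longlonglongrightarrow> b"
    using Cauchy_convergent convergent_def by blast
  have bA: "b \<in> A"
    using closed_sequentially[OF assms(2)] aA b by blast
  have "(norm (b - p))\<^sup>2 \<le> d\<^sup>2 + 0"
  proof (rule LIMSEQ_le)
    show "(\<lambda>n. (norm (a n - p))\<^sup>2) \<longlonglongrightarrow> (norm (b - p))\<^sup>2"
      by (intro tendsto_intros b)
    show "(\<lambda>n. d\<^sup>2 + inverse (real (Suc n))) \<longlonglongrightarrow> d\<^sup>2 + 0"
      by (intro tendsto_intros LIMSEQ_inverse_real_of_nat)
    show "\<exists>N. \<forall>n\<ge>N. (norm (a n - p))\<^sup>2 \<le> d\<^sup>2 + inverse (real (Suc n))"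
      using ad less_imp_le by blast
  qed
  then have "norm (b - p) \<le> d" using d0 by (simp add: power2_le_iff_abs_le)
  then show thesis using that[OF bA] d_le order_trans by blast
qed

lemma closest_point_variational:
  fixes a p z :: "'v::real_inner"
  assumes "convex A" "a \<in> A" "z \<in> A" and min: "\<And>z. z \<in> A \<Longrightarrow> norm (a - p) \<le> norm (z - p)"
  shows "inner (p - a) (z - a) \<le> 0"
proof (rule ccontr)
  assume "\<not> ?thesis"
  then have pos: "inner (p - a) (z - a) > 0" by simp
  define N where "N = (norm (z - a))\<^sup>2"
  define t where "t = min 1 (inner (p - a) (z - a) / (N + 1))"
  have N: "N \<ge> 0" by (simp add: N_def)
  have t: "0 < t" "t \<le> 1" "t \<le> inner (p - a) (z - a) / (N + 1)"
    using pos N by (auto simp: t_def)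
  have tN: "t * N < 2 * inner (p - a) (z - a)"
    using t(3) N pos t(1) by (simp add: field_simps)
  have "(1 - t) *\<^sub>R a + t *\<^sub>R z \<in> A"
    using assms(1-3) t by (intro convexD) auto
  from min[OF this] have "(norm (a - p))\<^sup>2 \<le> (norm ((1 - t) *\<^sub>R a + t *\<^sub>R z - p))\<^sup>2"
    by (intro power_mono) auto
  also have "(1 - t) *\<^sub>R a + t *\<^sub>R z - p = (a - p) + t *\<^sub>R (z - a)"
    by (simp add: algebra_simps)
  also have "(norm \<dots>)\<^sup>2 = (norm (a - p))\<^sup>2 + t * (t * N - 2 * inner (p - a) (z - a))"
    unfolding power2_norm_eq_inner N_def
    by (simp add: algebra_simps inner_commute power2_eq_square)
  finally have "0 \<le> t * (t * N - 2 * inner (p - a) (z - a))" by simp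
  then show False using t(1) tN by (simp add: zero_le_mult_iff)
qed

lemma strict_separation_hilbert:
  fixes A :: "'v::{real_inner, complete_space} set"
  assumes "A \<noteq> {}" "closed A" "convex A" "y \<notin> A"
  obtains v c where "c > 0" "\<And>z. z \<in> A \<Longrightarrow> inner z v \<le> inner y v - c"
proof -
  obtain a where a: "a \<in> A" "\<And>z. z \<in> A \<Longrightarrow> norm (a - y) \<le> norm (z - y)"
    using closest_point_exists_hilbert[OF assms(1-3)] by blast
  show thesis
  proof (rule that[of "(norm (y - a))\<^sup>2" "y - a"])
    show "(norm (y - a))\<^sup>2 > 0" using a(1) assms(4) by auto
    fix z assume "z \<in> A"
    from closest_point_variational[OF assms(3) a(1) this a(2)]
    show "inner z (y - a) \<le> inner y (y - a) - (norm (y - a))\<^sup>2"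
      unfolding power2_norm_eq_inner by (simp add: algebra_simps inner_commute)
  qed
qed

text \<open>A closed convex set is determined by its support function.\<close>

lemma mem_if_le_support_fun:
  fixes A :: "'v::{real_inner, complete_space} set"
  assumes "A \<in> CBC" and le: "\<And>v. ereal (inner y v) \<le> support_fun v A"
  shows "y \<in> A"
proof (rule ccontr)
  assume "y \<notin> A"
  then obtain v c where vc: "c > 0" "\<And>z. z \<in> A \<Longrightarrow> inner z v \<le> inner y v - c"
    using strict_separation_hilbert[of A y] assms(1) unfolding CBC_def by blast
  have "support_fun v A \<le> ereal (inner y v - c)"
    unfolding support_fun_def using vc by (intro SUP_least) simp
  from order_trans[OF le this] show False using vc(1) by simp
qed

lemma riesz_representation:
  fixes f :: "'v::{real_inner, complete_space} \<Rightarrow> real"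
  assumes "bounded_linear f"
  obtains w where "\<And>x. f x = inner x w"
proof (cases "\<forall>x. f x = 0")
  case True
  then show ?thesis using that[of 0] by simp
next
  case False
  interpret bounded_linear f by fact
  \<comment> \<open>The point of smallest norm on the hyperplane \<open>f = 1\<close> is orthogonal to the kernel of \<open>f\<close>.\<close>
  define A where "A = {x. f x = 1}"
  from False obtain u where u: "f u \<noteq> 0" by blast
  have ne: "A \<noteq> {}" using u by (auto simp: A_def scaleR intro!: exI[of _ "(1 / f u) *\<^sub>R u"])
  have cl: "closed A" unfolding A_def
    by (intro closed_Collect_eq continuous_on continuous_intros)
  have cv: "convex A" unfolding A_def by (auto simp: convex_def add scaleR)
  obtain a where a: "a \<in> A" "\<And>z. z \<in> A \<Longrightarrow> norm (a - 0) \<le> norm (z - 0)"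
    using closest_point_exists_hilbert[OF ne cl cv] by blast
  have fa: "f a = 1" using a(1) by (simp add: A_def)
  have ge: "inner a z \<ge> 0" if "f z = 0" for z
  proof -
    have "a + z \<in> A" using fa that by (simp add: A_def add)
    from closest_point_variational[OF cv a(1) this a(2)] show ?thesis by simp
  qed
  have orth: "inner a z = 0" if "f z = 0" for z
    using ge[OF that] ge[of "- z"] that by (simp add: neg)
  have "f x = inner x ((1 / inner a a) *\<^sub>R a)" for x
  proof -
    have "a \<noteq> 0" using fa zero by auto
    moreover have "inner a (x - f x *\<^sub>R a) = 0"
      by (rule orth) (simp add: diff scaleR fa)
    ultimately show ?thesis by (simp add: inner_diff_right inner_commute field_simps)
  qed
  then show ?thesis using that by blast
qed

section \<open>Weak convergence\<close>

lemma weakly_converges_iff_inner: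
  fixes X :: "nat \<Rightarrow> 'v::{real_inner, complete_space}"
  shows "weakly_converges X x \<longleftrightarrow> (\<forall>v. (\<lambda>k. inner (X k) v) \<longlonglongrightarrow> inner x v)"
proof
  assume "weakly_converges X x"
  then show "\<forall>v. (\<lambda>k. inner (X k) v) \<longlonglongrightarrow> inner x v"
    unfolding weakly_converges_def using bounded_linear_inner_left by blast
next
  assume *: "\<forall>v. (\<lambda>k. inner (X k) v) \<longlonglongrightarrow> inner x v"
  show "weakly_converges X x"
    unfolding weakly_converges_def
  proof (intro allI impI)
    fix f :: "'v \<Rightarrow> real" assume "bounded_linear f"
    then obtain w where "\<And>x. f x = inner x w" using riesz_representation by blast
    then show "(\<lambda>k. f (X k)) \<longlonglongrightarrow> f x" using * by simp
  qed
qed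

lemma bounded_imp_weakly_convergent_subsequence:
  fixes X :: "nat \<Rightarrow> 'v::{real_inner, complete_space}" and D :: "'v set"
  assumes D: "countable D" "closure D = UNIV" and bd: "\<And>n. norm (X n) \<le> M"
  obtains x k where "strict_mono (k::nat \<Rightarrow> nat)" "weakly_converges (X \<circ> k) x"
proof -
  \<comment> \<open>Normalizing the test vectors makes the bound uniform, as the diagonal argument requires.\<close>
  have "norm (inner (X n) (sgn v)) \<le> M" for n v
  proof -
    have "norm (inner (X n) (sgn v)) \<le> norm (X n) * norm (sgn v)"
      using Cauchy_Schwarz_ineq2 by simp
    also have "\<dots> \<le> norm (X n)" by (simp add: norm_sgn)
    finally show ?thesis using bd[of n] by simp
  qed
  then obtain k where k: "strict_mono (k::nat \<Rightarrow> nat)"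
    and conv: "\<And>v. v \<in> D \<Longrightarrow> \<exists>r. (\<lambda>n. inner (X (k n)) (sgn v)) \<longlonglongrightarrow> r"
    using function_convergent_subsequence[OF D(1), of "\<lambda>n v. inner (X n) (sgn v)" M] by blast
  have convD: "Cauchy (\<lambda>n. inner (X (k n)) v)" if v: "v \<in> D" for v
  proof -
    obtain r where r: "(\<lambda>n. inner (X (k n)) (sgn v)) \<longlonglongrightarrow> r" using conv[OF v] by blast
    have "inner w v = norm v * inner w (sgn v)" for w
      by (cases "v = 0") (simp_all add: sgn_div_norm)
    then have "(\<lambda>n. inner (X (k n)) v) = (\<lambda>n. norm v * inner (X (k n)) (sgn v))"
      by (rule ext)
    moreover have "(\<lambda>n. norm v * inner (X (k n)) (sgn v)) \<longlonglongrightarrow> norm v * r"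
      by (intro tendsto_intros r)
    ultimately show ?thesis using LIMSEQ_imp_Cauchy by simp
  qed
  have M0: "M \<ge> 0" using order_trans[OF norm_ge_zero bd] .
  define \<phi> where "\<phi> v = lim (\<lambda>n. inner (X (k n)) v)" for v
  have "Cauchy (\<lambda>n. inner (X (k n)) v)" for v
  proof (rule metric_CauchyI)
    fix e :: real assume e: "e > 0"
    define \<epsilon> where "\<epsilon> = e / (3 * (M + 1))"
    have eps: "\<epsilon> > 0" using e M0 by (simp add: \<epsilon>_def)
    have Me: "M * \<epsilon> < e / 3" using e M0 by (simp add: \<epsilon>_def field_simps)
    obtain w where w: "w \<in> D" "dist w v < \<epsilon>"
      using D(2) eps closure_approachable[of v D] by auto
    have near: "\<bar>inner (X n) v - inner (X n) w\<bar> < e / 3" for n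
    proof -
      have "\<bar>inner (X n) (v - w)\<bar> \<le> norm (X n) * norm (v - w)" by (rule Cauchy_Schwarz_ineq2)
      also have "\<dots> \<le> M * \<epsilon>"
        using bd[of n] w(2) M0 by (intro mult_mono) (auto simp: dist_norm norm_minus_commute)
      finally show ?thesis using Me by (simp add: inner_diff_right)
    qed
    obtain N where N: "\<And>m n. m \<ge> N \<Longrightarrow> n \<ge> N \<Longrightarrow>
        dist (inner (X (k m)) w) (inner (X (k n)) w) < e / 3"
      using metric_CauchyD[OF convD[OF w(1)], of "e/3"] e by auto
    have "dist (inner (X (k m)) v) (inner (X (k n)) v) < e" if "m \<ge> N" "n \<ge> N" for m n
      using N[OF that] near[of "k m"] near[of "k n"] unfolding dist_real_def by linarith
    then show "\<exists>N. \<forall>m\<ge>N. \<forall>n\<ge>N. dist (inner (X (k m)) v) (inner (X (k n)) v) < e" by blast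
  qed
  then have "convergent (\<lambda>n. inner (X (k n)) v)" for v
    by (rule Cauchy_convergent)
  then have \<phi>: "(\<lambda>n. inner (X (k n)) v) \<longlonglongrightarrow> \<phi> v" for v
    unfolding \<phi>_def by (simp add: convergent_LIMSEQ_iff)
  have "bounded_linear \<phi>"
  proof (rule bounded_linear_intro[of _ M])
    fix v w :: 'v and r :: real
    have "(\<lambda>n. inner (X (k n)) (v + w)) \<longlonglongrightarrow> \<phi> v + \<phi> w"
      using tendsto_add[OF \<phi>[of v] \<phi>[of w]] by (simp add: inner_add_right)
    then show "\<phi> (v + w) = \<phi> v + \<phi> w" by (rule LIMSEQ_unique[OF \<phi>])
    have "(\<lambda>n. inner (X (k n)) (r *\<^sub>R v)) \<longlonglongrightarrow> r * \<phi> v"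
      using tendsto_mult[OF tendsto_const \<phi>[of v]] by (simp add: inner_scaleR_right)
    then show "\<phi> (r *\<^sub>R v) = r *\<^sub>R \<phi> v"
      unfolding real_scaleR_def by (rule LIMSEQ_unique[OF \<phi>])
    have "\<bar>inner (X (k n)) v\<bar> \<le> norm v * M" for n
    proof -
      have "\<bar>inner (X (k n)) v\<bar> \<le> norm (X (k n)) * norm v" by (rule Cauchy_Schwarz_ineq2)
      also have "\<dots> \<le> norm v * M"
        by (subst mult.commute) (intro mult_left_mono bd norm_ge_zero)
      finally show ?thesis .
    qed
    then show "norm (\<phi> v) \<le> norm v * M"
      by (intro tendsto_upperbound[OF tendsto_norm[OF \<phi>]]) simp_all
  qed
  then obtain x where "\<And>v. \<phi> v = inner v x" using riesz_representation[of \<phi>] by metis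
  then have "weakly_converges (X \<circ> k) x"
    unfolding weakly_converges_iff_inner using \<phi> by (simp add: inner_commute)
  with k show thesis by (rule that)
qed

lemma tendsto_imp_weakly_converges:
  "X \<longlonglongrightarrow> x \<Longrightarrow> weakly_converges X x"
  unfolding weakly_converges_def by (auto intro: bounded_linear.tendsto)

lemma weakly_seq_closedD:
  assumes "weakly_seq_closed A" "\<And>k. X k \<in> A" "weakly_converges X x"
  shows "x \<in> A"
  using assms unfolding weakly_seq_closed_def by blast

text \<open>This is the form in which c-upper hemicontinuity is used.\<close>

lemma weakly_seq_closed_support_fun_ge:
  assumes "c_uhc F"
  shows "weakly_seq_closed {x. ereal c \<le> support_fun v (F x)}"
  unfolding weakly_seq_closed_def
proof (intro allI impI)
  fix X x
  assume X: "\<forall>k. X k \<in> {x. ereal c \<le> support_fun v (F x)}" and w: "weakly_converges X x"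
  have "ereal c \<le> limsup (\<lambda>k. support_fun v (F (X k)))"
    using X by (intro le_Limsup) auto
  also have "\<dots> \<le> support_fun v (F x)"
    using assms w unfolding c_uhc_def by blast
  finally show "x \<in> {x. ereal c \<le> support_fun v (F x)}" by simp
qed

lemma weakly_seq_closed_imp_closed:
  assumes "weakly_seq_closed A"
  shows "closed A"
  using assms tendsto_imp_weakly_converges
  unfolding closed_sequential_limits weakly_seq_closed_def by blast

lemma weakly_seq_closed_inverse:
  fixes F :: "'v::{real_inner, complete_space} \<Rightarrow> 'v set"
  assumes "\<And>x. F x \<in> CBC" "c_uhc F"
  shows "weakly_seq_closed (inverse_setmap F y)"
proof -
  have "inverse_setmap F y = (\<Inter>v. {x. ereal (inner y v) \<le> support_fun v (F x)})"
    using mem_if_le_support_fun[OF assms(1)]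
    by (auto simp: inverse_setmap_def support_fun_def intro!: SUP_upper)
  then show ?thesis
    using weakly_seq_closed_support_fun_ge[OF assms(2)]
    unfolding weakly_seq_closed_def by blast
qed

lemma weakly_seq_closed_cball:
  fixes a :: "'v::{real_inner, complete_space}"
  shows "weakly_seq_closed (cball a r)"
  unfolding weakly_seq_closed_def
proof (intro allI impI)
  fix X x
  assume X: "\<forall>k. X k \<in> cball a r" and w: "weakly_converges X x"
  have "(\<lambda>k. inner (X k - a) (x - a)) \<longlonglongrightarrow> inner (x - a) (x - a)"
    using w tendsto_diff[of "\<lambda>k. inner (X k) (x - a)" _ _ "\<lambda>k. inner a (x - a)"]
    unfolding weakly_converges_iff_inner by (simp add: inner_diff_left)
  moreover have "inner (X k - a) (x - a) \<le> r * norm (x - a)" for k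
  proof -
    have "inner (X k - a) (x - a) \<le> norm (X k - a) * norm (x - a)" by (rule norm_cauchy_schwarz)
    also have "\<dots> \<le> r * norm (x - a)"
      using X by (intro mult_right_mono) (auto simp: dist_norm norm_minus_commute)
    finally show ?thesis .
  qed
  ultimately have "inner (x - a) (x - a) \<le> r * norm (x - a)"
    by (intro tendsto_upperbound[of _ _ sequentially]) auto
  then have "norm (x - a) * norm (x - a) \<le> r * norm (x - a)"
    by (simp add: power2_norm_eq_inner[symmetric] power2_eq_square)
  moreover have "0 \<le> r" using X by (metis zero_le_dist mem_cball order_trans)
  ultimately show "x \<in> cball a r"
    by (cases "x = a") (auto simp: dist_norm norm_minus_commute)
qed

section \<open>A fixed point theorem in coordinates\<close>

text \<open>
  Brouwer's fixed point theorem for the self-map of the cube \<open>[0,1]\<^sup>m\<close> with components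
  \<open>a \<mapsto> g i (\<Sum>j<m. a j w j)\<close>. The dimension \<open>m\<close> is a number and not a type, and the vectors \<open>w j\<close>
  may be linearly dependent. The proof passes to the limit in Kuhn's combinatorial lemma on grids of
  mesh \<open>1 / (p + 1)\<close>.
\<close>

lemma brouwer_coordinate_cube:
  fixes g :: "nat \<Rightarrow> 'a::real_normed_vector \<Rightarrow> real" and w :: "nat \<Rightarrow> 'a"
  assumes cont: "\<And>i. i < m \<Longrightarrow> continuous_on UNIV (g i)"
    and g0: "\<And>i x. i < m \<Longrightarrow> 0 \<le> g i x" and g1: "\<And>i x. i < m \<Longrightarrow> g i x \<le> 1"
  obtains a where "\<And>i. i < m \<Longrightarrow> a i = g i (\<Sum>j<m. a j *\<^sub>R w j)"
proof -
  define X where "X a = (\<Sum>j<m. a j *\<^sub>R w j)" for a :: "nat \<Rightarrow> real"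
  define grid where "grid p r = (\<lambda>i. real (r i) / real (Suc p))" for p and r :: "nat \<Rightarrow> nat"
  have "\<exists>q. (\<forall>i<m. q i < Suc p) \<and> (\<forall>i<m. \<exists>r s.
      (\<forall>j<m. q j \<le> r j \<and> r j \<le> q j + 1) \<and> (\<forall>j<m. q j \<le> s j \<and> s j \<le> q j + 1) \<and>
      grid p r i \<le> g i (X (grid p r)) \<and> g i (X (grid p s)) \<le> grid p s i)" for p
  proof -
    \<comment> \<open>Label 0 means that the \<open>i\<close>-th component does not decrease, label 1 that it does not increase.\<close>
    define label :: "(nat \<Rightarrow> nat) \<Rightarrow> nat \<Rightarrow> nat" where
      "label r i = (if r i < Suc p \<and> grid p r i \<le> g i (X (grid p r)) then 0 else 1)" for r i
    have lab0: "grid p r i \<le> g i (X (grid p r))" if "label r i = 0" for r i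
      using that by (auto simp: label_def split: if_splits)
    have lab1: "g i (X (grid p r)) \<le> grid p r i" if "label r i = 1" "i < m" for r i
    proof (cases "r i < Suc p")
      case True
      then show ?thesis using that by (auto simp: label_def split: if_splits)
    next
      case False
      then have "1 \<le> grid p r i" by (simp add: grid_def field_simps)
      then show ?thesis using g1[OF that(2)] order_trans by blast
    qed
    obtain q where q: "\<forall>i<m. q i < Suc p"
      and rs: "\<forall>i<m. \<exists>r s. (\<forall>j<m. q j \<le> r j \<and> r j \<le> q j + 1) \<and>
        (\<forall>j<m. q j \<le> s j \<and> s j \<le> q j + 1) \<and> label r i \<noteq> label s i"
      by (rule kuhn_lemma[of "Suc p" m label]) (auto simp: label_def grid_def g0)
    have "\<exists>r s. (\<forall>j<m. q j \<le> r j \<and> r j \<le> q j + 1) \<and> (\<forall>j<m. q j \<le> s j \<and> s j \<le> q j + 1) \<and>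
      grid p r i \<le> g i (X (grid p r)) \<and> g i (X (grid p s)) \<le> grid p s i" if i: "i < m" for i
    proof -
      obtain r s where r: "\<forall>j<m. q j \<le> r j \<and> r j \<le> q j + 1"
        and s: "\<forall>j<m. q j \<le> s j \<and> s j \<le> q j + 1" and ne: "label r i \<noteq> label s i"
        using rs i by blast
      then consider "label r i = 0" "label s i = 1" | "label s i = 0" "label r i = 1"
        by (auto simp: label_def split: if_splits)
      then show ?thesis
        using r s lab0 lab1 i by cases blast+
    qed
    then show ?thesis using q by blast
  qed
  then obtain q where q: "\<And>p i. i < m \<Longrightarrow> q p i < Suc p"
    and rs: "\<And>p i. i < m \<Longrightarrow> \<exists>r s.
      (\<forall>j<m. q p j \<le> r j \<and> r j \<le> q p j + 1) \<and> (\<forall>j<m. q p j \<le> s j \<and> s j \<le> q p j + 1) \<and>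
      grid p r i \<le> g i (X (grid p r)) \<and> g i (X (grid p s)) \<le> grid p s i"
    by metis
  have "\<bar>grid p (q p) i\<bar> \<le> 1" if "i \<in> {..<m}" for p i
    using q[of i p] that by (simp add: grid_def field_simps)
  then have bd: "norm (grid p (q p) i) \<le> 1" if "i \<in> {..<m}" for p i using that by simp
  obtain k where k: "strict_mono (k::nat \<Rightarrow> nat)"
    and lim: "\<And>i. i \<in> {..<m} \<Longrightarrow> \<exists>l. (\<lambda>n. grid (k n) (q (k n)) i) \<longlonglongrightarrow> l"
    using function_convergent_subsequence[OF countable_finite[OF finite_lessThan],
        of m "\<lambda>p i. grid p (q p) i" 1] bd by blast
  then obtain a where a: "\<And>i. i < m \<Longrightarrow> (\<lambda>n. grid (k n) (q (k n)) i) \<longlonglongrightarrow> a i"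
    by (metis lessThan_iff)
  have mesh: "(\<lambda>n. inverse (real (Suc (k n)))) \<longlonglongrightarrow> 0"
    using LIMSEQ_subseq_LIMSEQ[OF LIMSEQ_inverse_real_of_nat k] by (simp add: o_def)
  have near: "(\<lambda>n. grid (k n) (r n) j) \<longlonglongrightarrow> a j"
    if "\<And>n. q (k n) j \<le> r n j \<and> r n j \<le> q (k n) j + 1" "j < m" for r j
  proof (rule tendsto_sandwich[OF _ _ a[OF that(2)]])
    show "\<forall>\<^sub>F n in sequentially. grid (k n) (q (k n)) j \<le> grid (k n) (r n) j"
      using that(1) by (simp add: grid_def divide_right_mono)
    have "grid (k n) (r n) j \<le> grid (k n) (q (k n)) j + inverse (real (Suc (k n)))" for n
    proof -
      have "real (r n j) \<le> real (q (k n) j) + 1" using that(1)[of n] by linarith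
      from divide_right_mono[OF this, of "real (Suc (k n))"] show ?thesis
        by (simp add: grid_def add_divide_distrib inverse_eq_divide)
    qed
    then show "\<forall>\<^sub>F n in sequentially. grid (k n) (r n) j
        \<le> grid (k n) (q (k n)) j + inverse (real (Suc (k n)))" by simp
    show "(\<lambda>n. grid (k n) (q (k n)) j + inverse (real (Suc (k n)))) \<longlonglongrightarrow> a j"
      using tendsto_add[OF a[OF that(2)] mesh] by simp
  qed
  have limg: "(\<lambda>n. g i (X (grid (k n) (r n)))) \<longlonglongrightarrow> g i (X a)"
    if "\<And>n j. j < m \<Longrightarrow> q (k n) j \<le> r n j \<and> r n j \<le> q (k n) j + 1" "i < m" for r i
  proof -
    have "(\<lambda>n. X (grid (k n) (r n))) \<longlonglongrightarrow> X a"
      unfolding X_def using that(1) by (intro tendsto_sum tendsto_scaleR near tendsto_const) auto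
    moreover have "isCont (g i) (X a)"
      using cont[OF that(2)] by (simp add: continuous_on_eq_continuous_at)
    ultimately show ?thesis by (rule isCont_tendsto_compose[rotated])
  qed
  have "a i = g i (X a)" if i: "i < m" for i
  proof -
    obtain r s where r: "\<And>p j. j < m \<Longrightarrow> q p j \<le> r p j \<and> r p j \<le> q p j + 1"
      and s: "\<And>p j. j < m \<Longrightarrow> q p j \<le> s p j \<and> s p j \<le> q p j + 1"
      and rg: "\<And>p. grid p (r p) i \<le> g i (X (grid p (r p)))"
      and sg: "\<And>p. g i (X (grid p (s p))) \<le> grid p (s p) i"
      using rs[OF i] by metis
    have "a i \<le> g i (X a)"
      using LIMSEQ_le[OF near[of i "\<lambda>n. r (k n)"] limg[of "\<lambda>n. r (k n)" i]] r rg i by blast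
    moreover have "g i (X a) \<le> a i"
      using LIMSEQ_le[OF limg[of "\<lambda>n. s (k n)" i] near[of i "\<lambda>n. s (k n)"]] s sg i by blast
    ultimately show ?thesis by simp
  qed
  then show thesis using that unfolding X_def by blast
qed

section \<open>Solvability of the inclusion\<close>

text \<open>The distance to the complement of \<open>U\<close> is such a function, unless \<open>U\<close> is the whole space.\<close>

lemma open_cutoff:
  fixes U :: "'a::metric_space set"
  assumes "open U"
  obtains f :: "'a \<Rightarrow> real" where "continuous_on UNIV f" "\<And>x. f x \<ge> 0" "\<And>x. f x > 0 \<longleftrightarrow> x \<in> U"
proof (cases "U = UNIV")
  case True
  then show ?thesis using that[of "\<lambda>_. 1"] by simp
next
  case False
  have "infdist x (- U) > 0 \<longleftrightarrow> x \<in> U" for x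
    using False assms in_closed_iff_infdist_zero[of "- U" x] infdist_nonneg[of x "- U"]
    by (auto simp: closed_Compl less_le)
  then show ?thesis
    using that[of "\<lambda>x. infdist x (- U)"] by (simp add: infdist_nonneg continuous_on_infdist)
qed

text \<open>
  Completing the square: the quadratic inequality describes the closed ball whose diameter joins
  \<open>a\<close> to \<open>a + p / l\<close>.
\<close>

lemma dissipativity_region_eq_cball:
  fixes a p x :: "'v::real_inner"
  assumes "l < 0"
  shows "inner p (x - a) \<le> l * (norm (x - a))\<^sup>2 \<longleftrightarrow>
    x \<in> cball (a + (1 / (2 * l)) *\<^sub>R p) (norm p / (2 * - l))"
proof -
  have eq: "(norm (x - (a + (1 / (2 * l)) *\<^sub>R p)))\<^sup>2 - (norm p / (2 * - l))\<^sup>2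
      = (norm (x - a))\<^sup>2 - inner p (x - a) / l"
    unfolding power_divide power2_norm_eq_inner using assms
    by (simp add: algebra_simps inner_commute power2_eq_square diff_divide_distrib)
  have "x \<in> cball (a + (1 / (2 * l)) *\<^sub>R p) (norm p / (2 * - l)) \<longleftrightarrow>
      norm (x - (a + (1 / (2 * l)) *\<^sub>R p)) \<le> norm p / (2 * - l)"
    by (simp only: mem_cball dist_norm norm_minus_commute)
  also have "\<dots> \<longleftrightarrow> (norm (x - (a + (1 / (2 * l)) *\<^sub>R p)))\<^sup>2 \<le> (norm p / (2 * - l))\<^sup>2"
    using assms by (intro power_mono_iff[symmetric] divide_nonneg_pos) auto
  also have "\<dots> \<longleftrightarrow> (norm (x - a))\<^sup>2 - inner p (x - a) / l \<le> 0"
    using eq by linarith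
  also have "\<dots> \<longleftrightarrow> inner p (x - a) \<le> l * (norm (x - a))\<^sup>2"
    using assms by (simp add: field_simps)
  finally show ?thesis by blast
qed

text \<open>
  A separating direction can be scaled to give any margin, and the boundedness of \<open>A\<close> then allows
  to move it slightly into a dense set.
\<close>

lemma ex_strict_support_separation:
  fixes A :: "'v::{real_inner, complete_space} set"
  assumes A: "A \<in> CBC" and y: "y \<notin> A" and D: "closure D = (UNIV :: 'v set)"
  shows "\<exists>v\<in>D. support_fun v A < ereal (inner y v - 1)"
proof -
  obtain w c where c: "c > 0" and w: "\<And>z. z \<in> A \<Longrightarrow> inner z w \<le> inner y w - c"
    using strict_separation_hilbert[of A y] A y unfolding CBC_def by blast
  obtain M where M: "\<And>z. z \<in> A \<Longrightarrow> norm z \<le> M"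
    using A unfolding CBC_def bounded_iff by blast
  define b where "b = M + norm y"
  have b0: "b \<ge> 0"
    using M A unfolding CBC_def b_def by (smt (verit) ex_in_conv mem_Collect_eq norm_ge_zero)
  \<comment> \<open>The factor \<open>3 / c\<close> gives the margin 3; the perturbation costs at most 1 of it.\<close>
  have "1 / (b + 1) > 0" using b0 by simp
  moreover have "(3 / c) *\<^sub>R w \<in> closure D" using D by simp
  ultimately obtain v where v: "v \<in> D" "dist v ((3 / c) *\<^sub>R w) < 1 / (b + 1)"
    unfolding closure_approachable by blast
  have "inner z v \<le> inner y v - 2" if z: "z \<in> A" for z
  proof -
    have "inner (z - y) (v - (3 / c) *\<^sub>R w) \<le> norm (z - y) * norm (v - (3 / c) *\<^sub>R w)"
      by (rule norm_cauchy_schwarz)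
    also have "\<dots> \<le> b * (1 / (b + 1))"
      using M[OF z] norm_triangle_ineq4[of z y] v(2) b0
      by (intro mult_mono) (auto simp: b_def dist_norm)
    also have "\<dots> \<le> 1" using b0 by simp
    finally have "inner (z - y) v \<le> 1 + (3 / c) * inner (z - y) w"
      by (simp add: inner_diff_right)
    moreover have "(3 / c) * inner (z - y) w \<le> (3 / c) * (- c)"
      using w[OF z] c by (intro mult_left_mono) (auto simp: inner_diff_left)
    ultimately show ?thesis using c by (simp add: inner_diff_left)
  qed
  then have "support_fun v A \<le> ereal (inner y v - 2)"
    unfolding support_fun_def by (intro SUP_least) simp
  also have "\<dots> < ereal (inner y v - 1)" by simp
  finally show ?thesis using v(1) by blast
qed

text \<open>
  The conclusion locates the solution in the ball of radius \<open>|y - y0| / (2 * (- l))\<close> that has \<open>x0\<close>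
  on its boundary, and not just in the ball of twice this radius around \<open>x0\<close>, to which the
  Lipschitz estimate alone would confine it. The smaller ball is what makes the inverse relaxed
  one-sided Lipschitz.
\<close>

lemma solvability_in_dissipativity_region:
  fixes F :: "'v::{real_inner, complete_space} \<Rightarrow> 'v set"
  assumes sep: "separable_space (euclidean :: 'v topology)"
    and CBC: "\<And>x. F x \<in> CBC" and uhc: "c_uhc F" and bd: "bounded_on_bounded_sets F"
    and rosl: "relaxed_one_sided_lipschitz l F" and l: "l < 0"
    and y0: "y0 \<in> F x0"
  shows "\<exists>x. y \<in> F x \<and> inner (y - y0) (x - x0) \<le> l * (norm (x - x0))\<^sup>2"
proof (rule ccontr)
  assume none: "\<not> ?thesis"
  define B where "B = {x. inner (y - y0) (x - x0) \<le> l * (norm (x - x0))\<^sup>2}"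
  have noB: "y \<notin> F x" if "x \<in> B" for x
    using none that unfolding B_def by blast
  obtain b r where B_ball: "B = cball b r"
    using dissipativity_region_eq_cball[OF l] unfolding B_def by blast
  have x0B: "x0 \<in> B" by (simp add: B_def)

  obtain E where E: "countable E" "closure E = (UNIV :: 'v set)"
    using sep unfolding separable_space_def by auto
  then have "E \<noteq> {}" by auto
  define d where "d = from_nat_into E"
  have d: "range d = E" unfolding d_def using E(1) \<open>E \<noteq> {}\<close> by (rule range_from_nat_into[rotated])
  define U where "U n = {x. support_fun (d n) (F x) < ereal (inner y (d n) - 1)}" for n
  have U_compl: "- U n = {x. ereal (inner y (d n) - 1) \<le> support_fun (d n) (F x)}" for n
    by (auto simp: U_def)
  have wclosed: "weakly_seq_closed (- U n)" for n
    unfolding U_compl by (rule weakly_seq_closed_support_fun_ge[OF uhc])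
  then have openU: "open (U n)" for n
    unfolding open_closed by (rule weakly_seq_closed_imp_closed)
  have cover: "\<exists>n. x \<in> U n" if "x \<in> B" for x
    using ex_strict_support_separation[OF CBC noB[OF that] E(2)] d by (force simp: U_def)

  \<comment> \<open>A countable cover by weakly sequentially open sets of a weakly sequentially compact set has a
    finite subcover.\<close>
  have "\<exists>N. B \<subseteq> (\<Union>n<N. U n)"
  proof (rule ccontr)
    assume "\<not> ?thesis"
    then have "\<forall>N. \<exists>x. x \<in> B \<and> x \<notin> (\<Union>n<N. U n)" by blast
    then obtain X where X: "\<And>N. X N \<in> B" "\<And>N. X N \<notin> (\<Union>n<N. U n)" by metis
    obtain M where "\<And>n. norm (X n) \<le> M"
      using X(1) bounded_cball[of b r] unfolding B_ball bounded_iff by blast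
    then obtain x k where k: "strict_mono (k::nat \<Rightarrow> nat)" and x: "weakly_converges (X \<circ> k) x"
      by (rule bounded_imp_weakly_convergent_subsequence[OF E])
    have "x \<in> B"
      using weakly_seq_closedD[OF weakly_seq_closed_cball _ x] X(1) by (simp add: B_ball)
    then obtain n where n: "x \<in> U n" using cover by blast
    have "weakly_converges (\<lambda>j. X (k (j + Suc n))) x"
      unfolding weakly_converges_def
    proof (intro allI impI)
      fix f :: "'v \<Rightarrow> real" assume "bounded_linear f"
      then have "(\<lambda>j. f (X (k j))) \<longlonglongrightarrow> f x"
        using x by (simp add: weakly_converges_def)
      then show "(\<lambda>j. f (X (k (j + Suc n)))) \<longlonglongrightarrow> f x"
        by (rule LIMSEQ_ignore_initial_segment)
    qed
    moreover have "X (k (j + Suc n)) \<in> - U n" for j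
    proof -
      have "n < k (j + Suc n)" using seq_suble[OF k, of "j + Suc n"] by simp
      then show ?thesis using X(2)[of "k (j + Suc n)"] by blast
    qed
    ultimately have "x \<in> - U n" by (rule weakly_seq_closedD[OF wclosed, rotated])
    then show False using n by blast
  qed
  then obtain N where N: "B \<subseteq> (\<Union>n<N. U n)" ..

  \<comment> \<open>A continuous partition of unity: \<open>\<phi> n\<close> lives on \<open>U n\<close>, and \<open>\<phi>0\<close> on the complement of \<open>B\<close>.\<close>
  have "\<exists>f :: 'v \<Rightarrow> real. continuous_on UNIV f \<and> (\<forall>x. f x \<ge> 0) \<and> (\<forall>x. f x > 0 \<longleftrightarrow> x \<in> U n)" for n
    using open_cutoff[OF openU] by metis
  then obtain \<psi> :: "nat \<Rightarrow> 'v \<Rightarrow> real" where \<psi>_cont: "\<And>n. continuous_on UNIV (\<psi> n)"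
    and \<psi>_nonneg: "\<And>n x. \<psi> n x \<ge> 0" and \<psi>_pos: "\<And>n x. \<psi> n x > 0 \<longleftrightarrow> x \<in> U n"
    by metis
  define \<beta> where "\<beta> x = max 0 (inner (y - y0) (x - x0) - l * (norm (x - x0))\<^sup>2)" for x
  have \<beta>_cont: "continuous_on UNIV \<beta>" unfolding \<beta>_def by (intro continuous_intros)
  have \<beta>_nonneg: "\<beta> x \<ge> 0" for x by (simp add: \<beta>_def)
  have \<beta>_pos: "\<beta> x > 0 \<longleftrightarrow> x \<notin> B" for x by (auto simp: \<beta>_def B_def)
  define s where "s x = \<beta> x + (\<Sum>n<N. \<psi> n x)" for x
  have s_pos: "s x > 0" for x
  proof (cases "x \<in> B")
    case True
    then obtain n where "n < N" "\<psi> n x > 0" using N \<psi>_pos by blast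
    then have "(\<Sum>n<N. \<psi> n x) > 0"
      using \<psi>_nonneg by (intro sum_pos2[of _ n]) auto
    then show ?thesis using \<beta>_nonneg[of x] by (simp add: s_def)
  next
    case False
    then show ?thesis using \<beta>_pos[of x] \<psi>_nonneg unfolding s_def
      by (intro add_pos_nonneg sum_nonneg) auto
  qed
  have s_cont: "continuous_on UNIV s"
    unfolding s_def by (intro continuous_intros \<beta>_cont \<psi>_cont)
  define \<phi>0 where "\<phi>0 x = \<beta> x / s x" for x
  define \<phi> where "\<phi> n x = \<psi> n x / s x" for n x
  have \<phi>0_nonneg: "\<phi>0 x \<ge> 0" and \<phi>_nonneg: "\<phi> n x \<ge> 0" for n x
    using \<beta>_nonneg \<psi>_nonneg s_pos by (auto simp: \<phi>0_def \<phi>_def intro!: divide_nonneg_pos)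
  have partition: "\<phi>0 x + (\<Sum>n<N. \<phi> n x) = 1" for x
    using s_pos[of x] unfolding \<phi>0_def \<phi>_def sum_divide_distrib[symmetric]
    by (simp add: s_def add_divide_distrib[symmetric])
  have \<phi>_le_1: "\<phi> n x \<le> 1" if "n < N" for n x
  proof -
    have "\<phi> n x \<le> (\<Sum>n<N. \<phi> n x)" using that \<phi>_nonneg by (intro member_le_sum) auto
    then show ?thesis using partition[of x] \<phi>0_nonneg[of x] by linarith
  qed
  have \<phi>0_cont: "continuous_on UNIV \<phi>0" and \<phi>_cont: "continuous_on UNIV (\<phi> n)" for n
    unfolding \<phi>0_def \<phi>_def using s_pos
    by (intro continuous_intros \<beta>_cont \<psi>_cont s_cont; metis less_irrefl)+

  have "bounded (\<Union>x\<in>B. F x)"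
    using bd unfolding bounded_on_bounded_sets_def B_ball by blast
  then obtain M where M: "\<And>x z. x \<in> B \<Longrightarrow> z \<in> F x \<Longrightarrow> norm z \<le> M"
    unfolding bounded_iff by blast
  obtain R where R: "\<And>x. x \<in> B \<Longrightarrow> norm x \<le> R"
    using bounded_cball[of b r] unfolding B_ball bounded_iff by blast
  define C where "C = (M + norm y) * (R + norm x0)"
  have MR: "M \<ge> 0" "R \<ge> 0"
    using M[OF x0B y0] R[OF x0B] norm_ge_zero order_trans by blast+
  then have C0: "C \<ge> 0" by (simp add: C_def)
  have C: "inner (z - y) (x - x0) \<le> C" if "x \<in> B" "z \<in> F x" for x z
  proof -
    have "inner (z - y) (x - x0) \<le> norm (z - y) * norm (x - x0)" by (rule norm_cauchy_schwarz)
    also have "\<dots> \<le> C" unfolding C_def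
      using M[OF that] R[OF that(1)] norm_triangle_ineq4[of z y] norm_triangle_ineq4[of x x0] MR
      by (intro mult_mono) auto
    finally show ?thesis .
  qed
  \<comment> \<open>So small that \<open>\<tau> (z - y, x - x0)\<close> cannot reach the separation margin 1 for \<open>x \<in> B\<close>.\<close>
  define \<tau> where "\<tau> = 1 / (C + 1)"
  have \<tau>: "\<tau> > 0" "\<tau> * C < 1" using C0 by (auto simp: \<tau>_def field_simps)

  \<comment> \<open>Solving the equilibrium equation for \<open>x - x0\<close> leads to the coefficients
    \<open>\<phi> n x / (\<phi>0 x + \<tau>)\<close> of \<open>- d n\<close>; the factor \<open>\<tau>\<close> rescales them to \<open>[0,1]\<close>.\<close>
  define g where "g n u = \<tau> * \<phi> n (x0 + u) / (\<phi>0 (x0 + u) + \<tau>)" for n u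
  have den: "\<phi>0 x + \<tau> > 0" for x using \<phi>0_nonneg[of x] \<tau> by linarith
  have "continuous_on UNIV (g n)" if "n < N" for n
  proof -
    have "continuous_on UNIV (\<lambda>u. \<phi>0 (x0 + u))" "continuous_on UNIV (\<lambda>u. \<phi> n (x0 + u))"
      by (auto intro!: continuous_on_compose2[OF \<phi>0_cont] continuous_on_compose2[OF \<phi>_cont]
          continuous_intros)
    then show ?thesis unfolding g_def
      using den by (intro continuous_intros) (auto, metis less_irrefl)
  qed
  moreover have "0 \<le> g n u" if "n < N" for n u
    using \<phi>_nonneg \<tau> den unfolding g_def by (simp add: less_imp_le)
  moreover have "g n u \<le> 1" if "n < N" for n u
  proof -
    have "\<tau> * \<phi> n (x0 + u) \<le> \<tau>" using \<phi>_le_1[OF that] \<tau> by (simp add: mult_left_le)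
    then have "\<tau> * \<phi> n (x0 + u) \<le> \<phi>0 (x0 + u) + \<tau>"
      using \<phi>0_nonneg[of "x0 + u"] by linarith
    then show ?thesis using den[of "x0 + u"] by (simp add: g_def)
  qed
  ultimately obtain a where a: "\<And>n. n < N \<Longrightarrow> a n = g n (\<Sum>j<N. a j *\<^sub>R (- (1 / \<tau>) *\<^sub>R d j))"
    using brouwer_coordinate_cube[of N g "\<lambda>j. - (1 / \<tau>) *\<^sub>R d j"] by blast
  define u where "u = (\<Sum>j<N. a j *\<^sub>R (- (1 / \<tau>) *\<^sub>R d j))"
  define x where "x = x0 + u"
  have "(\<phi>0 x + \<tau>) *\<^sub>R (x - x0) = (\<phi>0 x + \<tau>) *\<^sub>R (\<Sum>j<N. g j u *\<^sub>R (- (1 / \<tau>) *\<^sub>R d j))"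
    using a by (simp add: x_def u_def)
  also have "\<dots> = (\<Sum>j<N. - (\<phi> j x *\<^sub>R d j))"
    unfolding scaleR_right.sum
  proof (rule sum.cong)
    fix j
    have "g j u = \<tau> * \<phi> j x / (\<phi>0 x + \<tau>)" by (simp add: g_def x_def)
    then have "(\<phi>0 x + \<tau>) * (g j u * (- (1 / \<tau>))) = - \<phi> j x"
      using den[of x] \<tau>(1) by simp
    then show "(\<phi>0 x + \<tau>) *\<^sub>R g j u *\<^sub>R (- (1 / \<tau>)) *\<^sub>R d j = - (\<phi> j x *\<^sub>R d j)"
      by (simp only: scaleR_scaleR mult.assoc scaleR_minus_left[symmetric])
  qed simp
  finally have equilibrium: "\<phi>0 x *\<^sub>R (x - x0) + (\<Sum>n<N. \<phi> n x *\<^sub>R d n) = - \<tau> *\<^sub>R (x - x0)"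
    by (simp add: sum_negf algebra_simps)

  obtain z where z: "z \<in> F x" and zl: "inner (z - y0) (x - x0) \<le> l * (norm (x - x0))\<^sup>2"
    using rosl y0 unfolding relaxed_one_sided_lipschitz_def by blast
  have test: "\<phi> n x * inner (z - y) (d n) \<le> - \<phi> n x" for n
  proof (cases "x \<in> U n")
    case True
    have "ereal (inner z (d n)) \<le> support_fun (d n) (F x)"
      unfolding support_fun_def using z by (rule SUP_upper)
    also have "\<dots> < ereal (inner y (d n) - 1)" using True by (simp add: U_def)
    finally have "inner (z - y) (d n) \<le> -1" by (simp add: inner_diff_left)
    then show ?thesis using mult_left_mono[OF _ \<phi>_nonneg] by fastforce
  next
    case False
    then have "\<phi> n x = 0" using \<psi>_pos[of n x] \<psi>_nonneg[of n x] by (simp add: \<phi>_def)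
    then show ?thesis by simp
  qed
  have "\<phi>0 x * inner (z - y) (x - x0) + (\<Sum>n<N. \<phi> n x * inner (z - y) (d n))
      = - \<tau> * inner (z - y) (x - x0)"
    using arg_cong[OF equilibrium, of "inner (z - y)"]
    by (simp add: inner_add_right inner_sum_right)
  moreover have "(\<Sum>n<N. \<phi> n x * inner (z - y) (d n)) \<le> - (\<Sum>n<N. \<phi> n x)"
    using sum_mono[of "{..<N}", OF test] by (simp add: sum_negf)
  ultimately have key: "(\<phi>0 x + \<tau>) * inner (z - y) (x - x0) \<ge> (\<Sum>n<N. \<phi> n x)"
    by (simp add: algebra_simps)
  show False
  proof (cases "x \<in> B")
    case True
    then have "\<phi>0 x = 0" using \<beta>_pos[of x] \<beta>_nonneg[of x] by (simp add: \<phi>0_def)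
    then have "1 \<le> \<tau> * inner (z - y) (x - x0)" using key partition[of x] by simp
    also have "\<dots> \<le> \<tau> * C" using C[OF True z] \<tau> by simp
    finally show False using \<tau> by simp
  next
    case False
    have "inner (z - y) (x - x0) < 0"
      using zl False by (simp add: B_def inner_diff_left)
    then have "(\<phi>0 x + \<tau>) * inner (z - y) (x - x0) < 0"
      using den mult_pos_neg by blast
    moreover have "(\<Sum>n<N. \<phi> n x) \<ge> 0" using \<phi>_nonneg by (intro sum_nonneg) auto
    ultimately show False using key by linarith
  qed
qed

section \<open>Properties of the inverse\<close>

lemma norm_le_if_inner_le:
  fixes p q :: "'v::real_inner"
  assumes "l < 0" "inner p q \<le> l * (norm q)\<^sup>2"
  shows "norm q \<le> - 1 / l * norm p"
proof (cases "q = 0")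
  case False
  have "- l * norm q * norm q \<le> - inner p q"
    using assms(2) by (simp add: power2_eq_square)
  also have "\<dots> \<le> norm p * norm q"
    using norm_cauchy_schwarz[of "- p" q] by simp
  finally have "- l * norm q \<le> norm p" using False by (simp only: mult_le_cancel_right) simp
  then show ?thesis using assms(1) by (simp add: field_simps)
qed (use assms(1) in \<open>simp add: divide_nonneg_neg\<close>)

theorem theorem14:
  fixes F :: "'v::{real_inner, complete_space} \<Rightarrow> 'v set" and l :: real
  assumes "separable_space (euclidean :: 'v topology)"
    and "\<And>x. F x \<in> CBC"
    and "c_uhc F"
    and "bounded_on_bounded_sets F"
    and "relaxed_one_sided_lipschitz l F"
    and "l < 0"
  shows "(\<forall>y. inverse_setmap F y \<noteq> {} \<and> weakly_seq_closed (inverse_setmap F y))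
    \<and> set_lipschitz (- 1 / l) (inverse_setmap F)
    \<and> relaxed_one_sided_lipschitz 0 (inverse_setmap F)
    \<and> (\<forall>y. set_norm (inverse_setmap F y)
            \<le> ereal (- 1 / l) * set_norm (F 0) + ereal (- 1 / l) * ereal (norm y))
    \<and> (\<forall>y. set_diam (inverse_setmap F y)
            \<le> ereal (- 1 / l) * (SUP x\<in>inverse_setmap F y. set_diam (F x)))
    \<and> bounded_on_bounded_sets (inverse_setmap F)"
proof -
  define L where "L = - 1 / l"
  have L: "L > 0" using assms(6) by (simp add: L_def)
  have solve: "\<exists>x'. y' \<in> F x' \<and> inner (y' - y) (x' - x) \<le> l * (norm (x' - x))\<^sup>2"
    if "y \<in> F x" for x y y'
    by (rule solvability_in_dissipativity_region[OF assms that])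
  have rosl: "\<exists>y'\<in>F x'. inner (y' - y) (x' - x) \<le> l * (norm (x' - x))\<^sup>2" if "y \<in> F x" for x x' y
    using assms(5) that unfolding relaxed_one_sided_lipschitz_def by blast
  have nonempty: "inverse_setmap F y \<noteq> {}" for y
  proof -
    obtain y0 where "y0 \<in> F 0" using assms(2)[of 0] unfolding CBC_def by blast
    from solve[OF this, of y] show ?thesis by (auto simp: inverse_setmap_def)
  qed
  have lipschitz: "set_lipschitz L (inverse_setmap F)"
    unfolding set_lipschitz_def excess_def
  proof (intro conjI allI nonempty SUP_least)
    fix y y' x assume "x \<in> inverse_setmap F y"
    then have "y \<in> F x" by (simp add: inverse_setmap_def)
    from solve[OF this, of y'] obtain x' where x': "y' \<in> F x'"
      and le: "inner (y' - y) (x' - x) \<le> l * (norm (x' - x))\<^sup>2" by blast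
    have "norm (x - x') \<le> L * norm (y - y')"
      using norm_le_if_inner_le[OF assms(6) le] by (simp add: L_def norm_minus_commute)
    then show "(INF x'\<in>inverse_setmap F y'. ereal (norm (x - x'))) \<le> ereal (L * norm (y - y'))"
      using x' by (intro INF_lower2[of x']) (auto simp: inverse_setmap_def)
  qed
  have monotone: "relaxed_one_sided_lipschitz 0 (inverse_setmap F)"
    unfolding relaxed_one_sided_lipschitz_def inverse_setmap_def
  proof (intro allI ballI)
    fix y y' x assume "x \<in> {x. y \<in> F x}"
    with solve[of y x y'] obtain x' where x': "y' \<in> F x'"
      and le: "inner (y' - y) (x' - x) \<le> l * (norm (x' - x))\<^sup>2" by blast
    have "l * (norm (x' - x))\<^sup>2 \<le> 0" using assms(6) by (simp add: mult_nonpos_nonneg)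
    then show "\<exists>x'\<in>{x. y' \<in> F x}. inner (x' - x) (y' - y) \<le> 0 * (norm (y' - y))\<^sup>2"
      using x' le by (auto simp: inner_commute intro!: exI[of _ x'])
  qed
  have norm_bound: "\<exists>z\<in>F 0. norm x \<le> L * norm z + L * norm y" if "y \<in> F x" for x y
  proof -
    obtain z where z: "z \<in> F 0" "inner (z - y) (0 - x) \<le> l * (norm (0 - x))\<^sup>2"
      using rosl[OF \<open>y \<in> F x\<close>] by blast
    have "norm x \<le> L * norm (z - y)"
      using norm_le_if_inner_le[OF assms(6) z(2)] by (simp add: L_def)
    also have "\<dots> \<le> L * (norm z + norm y)"
      using L norm_triangle_ineq4 by (intro mult_left_mono) auto
    finally show ?thesis using z(1) by (auto simp: algebra_simps)
  qed
  have set_norm_bound: "set_norm (inverse_setmap F y)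
      \<le> ereal L * set_norm (F 0) + ereal L * ereal (norm y)" for y
    unfolding set_norm_def[of "inverse_setmap F y"]
  proof (rule SUP_least)
    fix x assume "x \<in> inverse_setmap F y"
    then obtain z where z: "z \<in> F 0" "norm x \<le> L * norm z + L * norm y"
      using norm_bound by (auto simp: inverse_setmap_def)
    have "ereal (norm x) \<le> ereal L * ereal (norm z) + ereal L * ereal (norm y)"
      using z(2) by simp
    also have "\<dots> \<le> ereal L * set_norm (F 0) + ereal L * ereal (norm y)"
      unfolding set_norm_def using L z(1)
      by (intro add_right_mono ereal_mult_left_mono SUP_upper) auto
    finally show "ereal (norm x) \<le> ereal L * set_norm (F 0) + ereal L * ereal (norm y)" .
  qed
  have set_diam_bound: "set_diam (inverse_setmap F y)
      \<le> ereal L * (SUP x\<in>inverse_setmap F y. set_diam (F x))" for y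
    unfolding set_diam_def[of "inverse_setmap F y"]
  proof (intro SUP_least)
    fix x x' assume x: "x \<in> inverse_setmap F y" and x': "x' \<in> inverse_setmap F y"
    have "y \<in> F x" using x by (simp add: inverse_setmap_def)
    from rosl[OF this, of x'] obtain y' where y': "y' \<in> F x'"
      and le: "inner (y' - y) (x' - x) \<le> l * (norm (x' - x))\<^sup>2" by blast
    have "ereal (norm (x - x')) \<le> ereal L * ereal (norm (y' - y))"
      using norm_le_if_inner_le[OF assms(6) le] by (simp add: L_def norm_minus_commute)
    also have "ereal (norm (y' - y)) \<le> set_diam (F x')"
      unfolding set_diam_def using x' y'
      by (intro SUP_upper2[of y'] SUP_upper) (auto simp: inverse_setmap_def)
    also have "set_diam (F x') \<le> (SUP x\<in>inverse_setmap F y. set_diam (F x))"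
      using x' by (rule SUP_upper)
    finally show "ereal (norm (x - x')) \<le> ereal L * (SUP x\<in>inverse_setmap F y. set_diam (F x))"
      using L by (simp add: ereal_mult_left_mono)
  qed
  have bounded: "bounded_on_bounded_sets (inverse_setmap F)"
    unfolding bounded_on_bounded_sets_def
  proof (intro allI impI)
    fix B :: "'v set" assume "bounded B"
    then obtain b where b: "\<And>y. y \<in> B \<Longrightarrow> norm y \<le> b" unfolding bounded_iff by blast
    obtain c where c: "\<And>z. z \<in> F 0 \<Longrightarrow> norm z \<le> c"
      using assms(2)[of 0] unfolding CBC_def bounded_iff by blast
    have "norm x \<le> L * c + L * b" if "y \<in> B" "y \<in> F x" for x y
    proof -
      obtain z where z: "z \<in> F 0" "norm x \<le> L * norm z + L * norm y"
        using norm_bound[OF \<open>y \<in> F x\<close>] by blast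
      have "L * norm z \<le> L * c" "L * norm y \<le> L * b"
        using L b[OF \<open>y \<in> B\<close>] c[OF z(1)] by simp_all
      then show ?thesis using z(2) by linarith
    qed
    then show "bounded (\<Union>y\<in>B. inverse_setmap F y)"
      unfolding bounded_iff inverse_setmap_def by blast
  qed
  show ?thesis
    using nonempty weakly_seq_closed_inverse[OF assms(2,3)] lipschitz monotone
      set_norm_bound set_diam_bound bounded
    unfolding L_def by blast
qed

end
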